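(* Let $\mu$ be a nonzero $\sigma$-finite atomic measure on $(\Omega, \Sigma)$ and let $(A_n)$ be a countable partition of $\Omega$ formed by atoms up to a null set. For every $f \in L_1(\mu)$ with $\|f\| \leq 1$, we have $$dc(f)= 1+\|f\| -2 \sup_n \, |f|_{A_n}|\, \mu(A_n).$$
   Context: $L_1(\mu)=L_1(\Omega,\Sigma,\mu)$ is the real $L_1$-space. A set $A\in\Sigma$ is an atom if $0<\mu(A)<\infty$ and whenever $B\in\Sigma$, $B\subseteq A$, $\mu(B)<\mu(A)$, then $\mu(B)=0$. A $\sigma$-finite measure is atomic if every measurable set of positive measure contains an atom; then $\Omega$ is, up to a null set, a countable disjoint union of atoms $A_n$. A measurable function $f$ is almost everywhere constant on an atom $A$, and $f|_A$ denotes that constant value. For a real Banach space $X$, $B_X$, $S_X$, $X^*$ denote the closed unit ball, unit sphere and topological dual. A slice of $B_X$ is a set $S(x^*,\delta)=\{y\in B_X : x^*(y)>1-\delta\}$ with $x^*\in S_{X^*}$ and $\delta>0$. For $x\in B_X$, the Daugavet constant $dc(x)$ is the supremum of all $\alpha\ge 0$ such that for all $\varepsilon,\delta>0$ and all $y^*\in S_{X^*}$ there exists $y\in S(y^*,\delta)$ with $\|y-x\|>\alpha-\varepsilon$. Here $dc(f)$ is taken in $X=L_1(\mu)$. *)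

theory Defs
  imports "HOL-Analysis.Analysis" "HOL-Library.Function_Algebras"
begin

section \<open>Real-valued functions as a real vector space\<close>

instantiation "fun" :: (type, scaleR) scaleR
begin

definition scaleR_fun :: "real \<Rightarrow> ('a \<Rightarrow> 'b) \<Rightarrow> 'a \<Rightarrow> 'b"
  where "scaleR_fun c f = (\<lambda>x. c *\<^sub>R f x)"

instance ..

end

instance "fun" :: (type, real_vector) real_vector
  by standard (auto simp: scaleR_fun_def plus_fun_def fun_eq_iff scaleR_add_right scaleR_add_left)

section \<open>Daugavet constants\<close>

text \<open>
  A normed space is given by a linear subspace \<open>V\<close> of a real vector space together with a
  function \<open>N\<close> that is a seminorm on \<open>V\<close>; it stands for the quotient of \<open>V\<close> by the kernel of
  \<open>N\<close>. (A normed space that is a type is the case \<open>V = UNIV\<close>, \<open>N = norm\<close>.) Bounded linear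
  functionals do not distinguish points at \<open>N\<close>-distance \<open>0\<close>, see \<open>dual_space_cong\<close> below, so
  they are the functionals on the quotient. Functionals are total functions of which only the
  values on \<open>V\<close> matter.
\<close>

definition unit_ball_on :: "'v::real_vector set \<Rightarrow> ('v \<Rightarrow> real) \<Rightarrow> 'v set"
  where "unit_ball_on V N = {y \<in> V. N y \<le> 1}"

definition dual_space :: "'v::real_vector set \<Rightarrow> ('v \<Rightarrow> real) \<Rightarrow> ('v \<Rightarrow> real) set"
  where "dual_space V N = {\<phi>.
    (\<forall>x\<in>V. \<forall>y\<in>V. \<phi> (x + y) = \<phi> x + \<phi> y) \<and>
    (\<forall>c. \<forall>x\<in>V. \<phi> (c *\<^sub>R x) = c * \<phi> x) \<and>
    (\<exists>C. \<forall>x\<in>V. \<bar>\<phi> x\<bar> \<le> C * N x)}"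

definition dual_norm :: "'v::real_vector set \<Rightarrow> ('v \<Rightarrow> real) \<Rightarrow> ('v \<Rightarrow> real) \<Rightarrow> real"
  where "dual_norm V N \<phi> = (SUP y\<in>unit_ball_on V N. \<bar>\<phi> y\<bar>)"

definition dual_sphere :: "'v::real_vector set \<Rightarrow> ('v \<Rightarrow> real) \<Rightarrow> ('v \<Rightarrow> real) set"
  where "dual_sphere V N = {\<phi> \<in> dual_space V N. dual_norm V N \<phi> = 1}"

definition slice :: "'v::real_vector set \<Rightarrow> ('v \<Rightarrow> real) \<Rightarrow> ('v \<Rightarrow> real) \<Rightarrow> real \<Rightarrow> 'v set"
  where "slice V N \<phi> \<delta> = {y \<in> unit_ball_on V N. \<phi> y > 1 - \<delta>}"

text \<open>
  The supremum is taken in the reals. When the space is nontrivial and \<open>N x \<le> 1\<close>, the set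
  below contains \<open>0\<close> and is bounded above by \<open>2\<close>.
\<close>

definition daugavet_const :: "'v::real_vector set \<Rightarrow> ('v \<Rightarrow> real) \<Rightarrow> 'v \<Rightarrow> real"
  where "daugavet_const V N x = Sup {\<alpha>. 0 \<le> \<alpha> \<and>
    (\<forall>\<epsilon>>0. \<forall>\<delta>>0. \<forall>\<phi>\<in>dual_sphere V N. \<exists>y\<in>slice V N \<phi> \<delta>. N (y - x) > \<alpha> - \<epsilon>)}"

lemma dual_space_cong:
  assumes V: "subspace V" and \<phi>: "\<phi> \<in> dual_space V N"
    and x: "x \<in> V" and y: "y \<in> V" and 0: "N (x - y) = 0"
  shows "\<phi> x = \<phi> y"
proof -
  have d: "x - y \<in> V" using V x y by (rule subspace_diff)
  obtain C where "\<forall>z\<in>V. \<bar>\<phi> z\<bar> \<le> C * N z" using \<phi> by (auto simp: dual_space_def)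
  with d 0 have "\<phi> (x - y) = 0" by fastforce
  moreover have "\<phi> ((x - y) + y) = \<phi> (x - y) + \<phi> y"
    using \<phi> d y unfolding dual_space_def by blast
  ultimately show ?thesis by simp
qed

section \<open>The space \<open>L\<^sub>1\<close>, given by representatives\<close>

definition L1 :: "'a measure \<Rightarrow> ('a \<Rightarrow> real) set"
  where "L1 M = {f. integrable M f}"

definition L1_norm :: "'a measure \<Rightarrow> ('a \<Rightarrow> real) \<Rightarrow> real"
  where "L1_norm M f = (\<integral>x. \<bar>f x\<bar> \<partial>M)"

lemma subspace_L1: "subspace (L1 M)"
  by (auto simp: subspace_def L1_def scaleR_fun_def plus_fun_def zero_fun_def)

lemma L1_norm_diff_eq_0_iff:
  assumes "f \<in> L1 M" "g \<in> L1 M"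
  shows "L1_norm M (f - g) = 0 \<longleftrightarrow> (AE x in M. f x = g x)"
  using assms by (simp add: L1_norm_def L1_def integral_nonneg_eq_0_iff_AE)

section \<open>Atoms\<close>

definition is_atom :: "'a measure \<Rightarrow> 'a set \<Rightarrow> bool"
  where "is_atom M A \<longleftrightarrow> A \<in> sets M \<and> 0 < emeasure M A \<and> emeasure M A < \<infinity> \<and>
    (\<forall>B\<in>sets M. B \<subseteq> A \<longrightarrow> emeasure M B < emeasure M A \<longrightarrow> emeasure M B = 0)"

definition atomic_measure :: "'a measure \<Rightarrow> bool"
  where "atomic_measure M \<longleftrightarrow>
    (\<forall>B\<in>sets M. 0 < emeasure M B \<longrightarrow> (\<exists>A. A \<subseteq> B \<and> is_atom M A))"

text \<open>The value that a measurable \<open>f\<close> takes almost everywhere on the atom \<open>A\<close>.\<close>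

definition atom_value :: "'a measure \<Rightarrow> ('a \<Rightarrow> real) \<Rightarrow> 'a set \<Rightarrow> real"
  where "atom_value M f A = (THE c. AE x in M. x \<in> A \<longrightarrow> f x = c)"

end

theory Submission
  imports Defs
begin

text \<open>
  Let \<open>e\<^sub>n\<close> be the normalised indicator of \<open>A\<^sub>n\<close>. On an atom an integrable function is almost
  everywhere constant, so the span of the \<open>e\<^sub>n\<close> is dense and a functional of norm one is nearly
  normed by some \<open>\<plusminus>e\<^sub>n\<close>; the distance from \<open>\<plusminus>e\<^sub>n\<close> to \<open>f\<close> gives the lower bound. Conversely,
  the slices given by the functional \<open>\<plusminus>\<integral>\<^bsub>A\<^sub>n\<^esub>\<close>, with the sign of \<open>f\<close> on \<open>A\<^sub>n\<close>, shrink to \<open>\<plusminus>e\<^sub>n\<close>,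
  which gives the upper bound.
\<close>

section \<open>Integrable functions on a single atom\<close>

lemma set_integrable_integrable:
  fixes g :: "'a \<Rightarrow> real"
  assumes "integrable M g" "A \<in> sets M"
  shows "set_integrable M A g"
  unfolding set_integrable_def using assms(2,1) by (rule integrable_mult_indicator)

text \<open>The constant is the mean \<open>c\<close> of \<open>g\<close> over \<open>A\<close>. If
  \<open>{g < c}\<close> or \<open>{g > c}\<close> had positive measure inside \<open>A\<close>, it
  would fill \<open>A\<close> up to a null set, and \<open>g - c\<close> would have a strict sign
  almost everywhere on \<open>A\<close> although its integral over \<open>A\<close> is zero.\<close>

lemma atom_AE_const:
  fixes g :: "'a \<Rightarrow> real"
  assumes A: "is_atom M A" and g: "integrable M g"
  shows "AE x in M. x \<in> A \<longrightarrow> g x = (LINT x:A|M. g x) / measure M A"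
proof -
  define c where "c = (LINT x:A|M. g x) / measure M A"
  have Am [measurable]: "A \<in> sets M" and pos: "0 < emeasure M A" and fin: "emeasure M A < \<infinity>"
    using A by (auto simp: is_atom_def)
  have gm [measurable]: "g \<in> borel_measurable M" using g by auto
  have ig: "integrable M (\<lambda>x. indicator A x * g x)"
    using integrable_mult_indicator[OF Am g] by simp
  have ic: "integrable M (\<lambda>x. indicator A x * c)"
    using fin Am by (intro integrable_mult_left) simp
  have mpos: "0 < measure M A"
    using pos fin by (simp add: emeasure_eq_ennreal_measure)
  have eq: "(\<integral>x. indicator A x * g x \<partial>M) = (\<integral>x. indicator A x * c \<partial>M)"
    using mpos Am sets.sets_into_space[OF Am]
    by (simp add: c_def set_lebesgue_integral_def Int_absorb2)
  have null: "emeasure M B = 0"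
    if B: "B \<in> sets M" "B \<subseteq> A"
      and cmp: "(\<forall>x\<in>B. g x < c) \<or> (\<forall>x\<in>B. g x > c)" for B
  proof (rule ccontr)
    assume ne: "emeasure M B \<noteq> 0"
    have le: "emeasure M B \<le> emeasure M A" using B Am by (intro emeasure_mono)
    have full: "emeasure M B = emeasure M A"
      using A B ne le by (auto simp: is_atom_def less_le)
    have "emeasure M (A - B) = 0"
      using B full fin Am by (subst emeasure_Diff) auto
    then have "A - B \<in> null_sets M" using B Am by auto
    then have AEB: "AE x in M. x \<in> A \<longrightarrow> x \<in> B"
      by (rule AE_I') auto
    \<comment> \<open>The factor \<open>t\<close> is 1 or -1, chosen so that one argument covers
      both sides of \<open>c\<close>.\<close>
    obtain t where t: "\<And>x. x \<in> B \<Longrightarrow> 0 < t * (g x - c)"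
      using cmp by (auto intro: that[of 1] that[of "- 1"])
    define h where "h x = t * (indicator A x * g x - indicator A x * c)" for x
    have h: "integrable M h" "integral\<^sup>L M h = 0"
      using ig ic eq unfolding h_def by auto
    have AEh: "AE x in M. if x \<in> A then 0 < h x else h x = 0"
      using AEB by eventually_elim (use t in \<open>auto simp: h_def\<close>)
    have "AE x in M. 0 \<le> h x"
      using AEh by eventually_elim (auto split: if_splits)
    then have "AE x in M. h x = 0"
      using h integral_nonneg_eq_0_iff_AE[OF h(1)] by blast
    with AEh have "AE x in M. x \<notin> A"
      by eventually_elim (auto split: if_splits)
    then have "A \<in> null_sets M" by (subst AE_iff_null_sets) auto
    with pos show False by auto
  qed
  have m: "{x \<in> space M. x \<in> A \<and> g x < c} \<in> sets M" "{x \<in> space M. x \<in> A \<and> g x > c} \<in> sets M"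
    by measurable
  have "{x \<in> space M. x \<in> A \<and> g x < c} \<in> null_sets M"
    using m by (intro null_setsI null) auto
  moreover have "{x \<in> space M. x \<in> A \<and> g x > c} \<in> null_sets M"
    using m by (intro null_setsI null) auto
  ultimately have "{x \<in> space M. x \<in> A \<and> g x < c} \<union> {x \<in> space M. x \<in> A \<and> g x > c} \<in> null_sets M"
    by (rule null_sets.Un)
  then have "AE x in M. x \<in> A \<longrightarrow> g x = c"
    by (rule AE_I') auto
  then show ?thesis by (simp add: c_def)
qed

lemma atom_measure_pos: "is_atom M A \<Longrightarrow> 0 < measure M A"
  by (auto simp: is_atom_def emeasure_eq_ennreal_measure)

text \<open>An atom is not a null set, so two almost everywhere values must agree and the definite
  description denotes the mean. This turns the products in the formula into integrals over the
  atoms.\<close>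

lemma atom_value_eq:
  assumes A: "is_atom M A" and g: "integrable M g"
  shows "atom_value M g A = (LINT x:A|M. g x) / measure M A"
  unfolding atom_value_def
proof (rule the_equality)
  fix c assume c: "AE x in M. x \<in> A \<longrightarrow> g x = c"
  show "c = (LINT x:A|M. g x) / measure M A"
  proof (rule ccontr)
    assume ne: "c \<noteq> (LINT x:A|M. g x) / measure M A"
    have "AE x in M. x \<notin> A"
      using c atom_AE_const[OF A g] by eventually_elim (use ne in auto)
    then have "A \<in> null_sets M"
      using A by (subst AE_iff_null_sets) (auto simp: is_atom_def)
    with A show False by (auto simp: is_atom_def)
  qed
qed (rule atom_AE_const[OF A g])

text \<open>No cancellation can occur, because \<open>g\<close> is almost everywhere constant on
  \<open>A\<close>.\<close>

lemma set_integral_abs_atom: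
  fixes g :: "'a \<Rightarrow> real"
  assumes A: "is_atom M A" and g: "integrable M g"
  shows "(LINT x:A|M. \<bar>g x\<bar>) = \<bar>LINT x:A|M. g x\<bar>"
proof -
  define c where "c = (LINT x:A|M. g x) / measure M A"
  have [measurable]: "A \<in> sets M" "g \<in> borel_measurable M"
    using A g by (auto simp: is_atom_def)
  have "(LINT x:A|M. \<bar>g x\<bar>) = (LINT x:A|M. \<bar>c\<bar>)"
    using atom_AE_const[OF A g]
    by (intro set_lebesgue_integral_cong_AE) (auto simp: c_def)
  also have "\<dots> = \<bar>c\<bar> * measure M A"
    using A sets.sets_into_space[of A M]
    by (simp add: set_lebesgue_integral_def is_atom_def Int_absorb2)
  also have "\<dots> = \<bar>LINT x:A|M. g x\<bar>"
    using atom_measure_pos[OF A] by (simp add: c_def)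
  finally show ?thesis .
qed

text \<open>Both distance estimates below compare the two summands of this split separately.\<close>

lemma L1_norm_atom_split:
  assumes A: "is_atom M A" and g: "integrable M g"
  shows "L1_norm M g = \<bar>LINT x:A|M. g x\<bar> + (LINT x:space M - A|M. \<bar>g x\<bar>)"
proof -
  have Am: "A \<in> sets M" using A by (simp add: is_atom_def)
  have ig: "integrable M (\<lambda>x. \<bar>g x\<bar>)" using g by simp
  have "L1_norm M g = (LINT x:space M|M. \<bar>g x\<bar>)"
    unfolding L1_norm_def by (subst set_integral_space[OF ig]) simp
  also have "space M = A \<union> (space M - A)" using sets.sets_into_space[OF Am] by auto
  also have "(LINT x:\<dots>|M. \<bar>g x\<bar>) = (LINT x:A|M. \<bar>g x\<bar>) + (LINT x:space M - A|M. \<bar>g x\<bar>)"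
    using Am ig by (intro set_integral_Un) (auto intro: set_integrable_integrable)
  finally show ?thesis by (simp add: set_integral_abs_atom[OF A g])
qed

lemma abs_set_integral_le_L1_norm:
  assumes "is_atom M A" "g \<in> L1 M"
  shows "\<bar>LINT x:A|M. g x\<bar> \<le> L1_norm M g"
  using L1_norm_atom_split[OF assms(1), of g] assms(2)
  by (auto simp: L1_def set_lebesgue_integral_def intro!: integral_nonneg_AE)

section \<open>Normalised indicators and distance estimates\<close>

definition atom_unit :: "'a measure \<Rightarrow> 'a set \<Rightarrow> 'a \<Rightarrow> real"
  where "atom_unit M A = (\<lambda>x. indicator A x / measure M A)"

lemma atom_unit_L1: "is_atom M A \<Longrightarrow> atom_unit M A \<in> L1 M"
  by (auto simp: atom_unit_def L1_def is_atom_def)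

lemma set_integral_atom_unit:
  assumes A: "is_atom M A" shows "(LINT x:A|M. atom_unit M A x) = 1"
proof -
  have "A \<inter> space M = A" using A sets.sets_into_space by (force simp: is_atom_def)
  then show ?thesis
    using A atom_measure_pos[OF A]
    by (simp add: set_lebesgue_integral_def atom_unit_def is_atom_def mult_indicator_cong
        flip: indicator_inter_arith)
qed

lemma L1_norm_atom_unit:
  assumes A: "is_atom M A" shows "L1_norm M (atom_unit M A) = 1"
proof -
  have "A \<inter> space M = A" using A sets.sets_into_space by (force simp: is_atom_def)
  then show ?thesis
    using atom_measure_pos[OF A] by (simp add: L1_norm_def atom_unit_def)
qed

lemma L1_norm_scaleR: "L1_norm M (c *\<^sub>R g) = \<bar>c\<bar> * L1_norm M g"
  by (simp add: L1_norm_def scaleR_fun_def abs_mult)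

text \<open>With a the integral of \<open>f\<close> over \<open>A\<close>, the difference
  contributes \<open>\<bar>s - a\<bar>\<close>, at least \<open>1 - \<bar>a\<bar>\<close>, on
  \<open>A\<close>, and the remaining mass \<open>L1_norm M f - \<bar>a\<bar>\<close> of
  \<open>f\<close> off \<open>A\<close>. The bound holds for either sign \<open>s\<close>.\<close>

lemma L1_norm_diff_atom_unit:
  assumes A: "is_atom M A" and f: "f \<in> L1 M" and s: "\<bar>s\<bar> = 1"
  shows "1 + L1_norm M f - 2 * \<bar>LINT x:A|M. f x\<bar> \<le> L1_norm M (s *\<^sub>R atom_unit M A - f)"
proof -
  let ?y = "s *\<^sub>R atom_unit M A"
  have Am: "A \<in> sets M" using A by (simp add: is_atom_def)
  have f': "integrable M f" using f by (simp add: L1_def)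
  have y: "integrable M ?y"
    using atom_unit_L1[OF A] by (simp add: L1_def scaleR_fun_def)
  have d: "integrable M (?y - f)" using f' y by (simp add: fun_diff_def)
  have "(LINT x:A|M. (?y - f) x) = s - (LINT x:A|M. f x)"
    using set_integral_diff(2)[OF set_integrable_integrable[OF y Am] set_integrable_integrable[OF f' Am]]
      set_integral_atom_unit[OF A] by (simp add: scaleR_fun_def)
  moreover have "(LINT x:space M - A|M. \<bar>(?y - f) x\<bar>) = (LINT x:space M - A|M. \<bar>f x\<bar>)"
    using Am by (intro set_lebesgue_integral_cong) (auto simp: scaleR_fun_def atom_unit_def)
  ultimately show ?thesis
    using L1_norm_atom_split[OF A d] L1_norm_atom_split[OF A f'] s by linarith
qed

text \<open>The triangle inequality is applied off \<open>A\<close> only; the last two summands are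
  the masses of \<open>y\<close> and \<open>f\<close> there. For \<open>y\<close> in a thin slice
  given by integration over \<open>A\<close>, the mass of \<open>y\<close> off \<open>A\<close> is
  small.\<close>

lemma L1_norm_diff_le:
  assumes A: "is_atom M A" and f: "f \<in> L1 M" and y: "y \<in> L1 M"
  shows "L1_norm M (y - f) \<le> \<bar>(LINT x:A|M. y x) - (LINT x:A|M. f x)\<bar>
    + (L1_norm M y - \<bar>LINT x:A|M. y x\<bar>) + (L1_norm M f - \<bar>LINT x:A|M. f x\<bar>)"
proof -
  have Am: "A \<in> sets M" using A by (simp add: is_atom_def)
  have f': "integrable M f" and y': "integrable M y" using f y by (simp_all add: L1_def)
  have d: "integrable M (y - f)" using f' y' by (simp add: fun_diff_def)
  have i: "set_integrable M (space M - A) (\<lambda>x. \<bar>h x\<bar>)" if "integrable M h" for h :: "'a \<Rightarrow> real"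
    by (rule set_integrable_integrable) (use that Am in auto)
  have "(LINT x:A|M. (y - f) x) = (LINT x:A|M. y x) - (LINT x:A|M. f x)"
    using set_integral_diff(2)[OF set_integrable_integrable[OF y' Am] set_integrable_integrable[OF f' Am]]
    by simp
  moreover have "(LINT x:space M - A|M. \<bar>(y - f) x\<bar>)
      \<le> (LINT x:space M - A|M. \<bar>y x\<bar> + \<bar>f x\<bar>)"
    using i[OF d] set_integral_add(1)[OF i[OF y'] i[OF f']] by (intro set_integral_mono) auto
  moreover have "\<dots> = (LINT x:space M - A|M. \<bar>y x\<bar>) + (LINT x:space M - A|M. \<bar>f x\<bar>)"
    by (rule set_integral_add(2)[OF i[OF y'] i[OF f']])
  ultimately show ?thesis
    using L1_norm_atom_split[OF A d] L1_norm_atom_split[OF A f'] L1_norm_atom_split[OF A y']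
    by linarith
qed

section \<open>Functionals of norm one and their slices\<close>

lemma atom_functional_dual_sphere:
  assumes A: "is_atom M A" and s: "\<bar>s\<bar> = 1"
  shows "(\<lambda>y. s * (LINT x:A|M. y x)) \<in> dual_sphere (L1 M) (L1_norm M)"
proof -
  let ?\<phi> = "\<lambda>y. s * (LINT x:A|M. y x)"
  have Am: "A \<in> sets M" using A by (simp add: is_atom_def)
  have le: "\<bar>?\<phi> y\<bar> \<le> L1_norm M y" if "y \<in> L1 M" for y
    using abs_set_integral_le_L1_norm[OF A that] s by (simp add: abs_mult)
  have "?\<phi> \<in> dual_space (L1 M) (L1_norm M)"
    unfolding dual_space_def
  proof (intro CollectI conjI ballI allI exI)
    fix x y assume "x \<in> L1 M" "y \<in> L1 M"
    then show "?\<phi> (x + y) = ?\<phi> x + ?\<phi> y"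
      using set_integral_add(2)[of M A x y] Am
      by (simp add: L1_def set_integrable_integrable distrib_left)
  next
    fix y assume "y \<in> L1 M"
    then show "\<bar>?\<phi> y\<bar> \<le> 1 * L1_norm M y" using le by simp
  qed (simp add: scaleR_fun_def)
  moreover have "dual_norm (L1 M) (L1_norm M) ?\<phi> = 1"
    unfolding dual_norm_def
  proof (rule cSup_eq_maximum)
    \<comment> \<open>The signed unit is a point of the ball at which the norm of the functional is
      attained.\<close>
    have "s *\<^sub>R atom_unit M A \<in> unit_ball_on (L1 M) (L1_norm M)"
      using atom_unit_L1[OF A] L1_norm_atom_unit[OF A] s subspace_scale[OF subspace_L1]
      by (auto simp: unit_ball_on_def L1_norm_scaleR)
    moreover have "\<bar>?\<phi> (s *\<^sub>R atom_unit M A)\<bar> = 1"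
      using s set_integral_atom_unit[OF A] by (simp add: scaleR_fun_def abs_mult)
    ultimately show "1 \<in> (\<lambda>y. \<bar>?\<phi> y\<bar>) ` unit_ball_on (L1 M) (L1_norm M)"
      by (metis (no_types, lifting) image_eqI)
  next
    fix t assume "t \<in> (\<lambda>y. \<bar>?\<phi> y\<bar>) ` unit_ball_on (L1 M) (L1_norm M)"
    then show "t \<le> 1" using le by (force simp: unit_ball_on_def)
  qed
  ultimately show ?thesis by (simp add: dual_sphere_def)
qed

text \<open>On one atom \<open>g\<close> agrees almost everywhere with its integral times the
  normalised indicator, so \<open>K\<close> bounds the functional on that piece. The finite union
  follows by induction, since the norm is additive over disjoint atoms.\<close>

lemma dual_space_bound_on_atoms:
  fixes g :: "'a \<Rightarrow> real"
  assumes \<phi>: "\<phi> \<in> dual_space (L1 M) (L1_norm M)"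
    and g: "g \<in> L1 M" and J: "finite J" "J \<subseteq> I"
    and atom: "\<And>n. n \<in> I \<Longrightarrow> is_atom M (A n)" and disj: "disjoint_family_on A I"
    and K: "\<And>n. n \<in> I \<Longrightarrow> \<bar>\<phi> (atom_unit M (A n))\<bar> \<le> K"
  shows "\<bar>\<phi> (\<lambda>x. indicator (\<Union>n\<in>J. A n) x * g x)\<bar> \<le> K * (LINT x:(\<Union>n\<in>J. A n)|M. \<bar>g x\<bar>)"
  using J
proof (induction J)
  case empty
  have "\<phi> (0 *\<^sub>R g) = 0 * \<phi> g" using \<phi> g unfolding dual_space_def by blast
  then show ?case by (simp add: scaleR_fun_def zero_fun_def set_lebesgue_integral_def)
next
  case (insert n J)
  let ?U = "\<Union>n\<in>J. A n"
  have g': "integrable M g" using g by (simp add: L1_def)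
  have n: "is_atom M (A n)" using atom insert by auto
  have Am [measurable]: "A n \<in> sets M" using n by (simp add: is_atom_def)
  have Um [measurable]: "?U \<in> sets M"
    using insert atom by (intro sets.finite_UN) (auto simp: is_atom_def)
  have dis: "A n \<inter> ?U = {}"
    using disj insert unfolding disjoint_family_on_def by fastforce
  let ?a = "LINT x:A n|M. g x"
  let ?gA = "\<lambda>x. indicator (A n) x * g x" and ?gU = "\<lambda>x. indicator ?U x * g x"
  have L: "?gA \<in> L1 M" "?gU \<in> L1 M"
    using integrable_mult_indicator[OF Am g'] integrable_mult_indicator[OF Um g']
    by (simp_all add: L1_def)
  have "?a *\<^sub>R atom_unit M (A n) \<in> L1 M"
    by (intro subspace_scale[OF subspace_L1] atom_unit_L1 n)
  moreover have "AE x in M. ?gA x = (?a *\<^sub>R atom_unit M (A n)) x"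
    using atom_AE_const[OF n g']
    by eventually_elim (auto simp: atom_unit_def scaleR_fun_def indicator_def)
  \<comment> \<open>The two representatives are at distance zero in the seminorm, hence
    \<open>\<phi>\<close> takes the same value on both.\<close>
  ultimately have "\<phi> ?gA = \<phi> (?a *\<^sub>R atom_unit M (A n))"
    using L1_norm_diff_eq_0_iff[OF L(1)] dual_space_cong[OF subspace_L1 \<phi> L(1)] by blast
  also have "\<dots> = ?a * \<phi> (atom_unit M (A n))"
    using \<phi> atom_unit_L1[OF n] unfolding dual_space_def by blast
  finally have "\<bar>\<phi> ?gA\<bar> \<le> K * \<bar>?a\<bar>"
    using mult_right_mono[OF K[of n] abs_ge_zero[of ?a]] insert by (simp add: abs_mult mult.commute)
  then have 1: "\<bar>\<phi> ?gA\<bar> \<le> K * (LINT x:A n|M. \<bar>g x\<bar>)"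
    by (simp add: set_integral_abs_atom[OF n g'])
  have "(\<lambda>x. indicator (\<Union>n\<in>insert n J. A n) x * g x) = ?gA + ?gU"
    using dis by (auto simp: fun_eq_iff indicator_def)
  then have 2: "\<phi> (\<lambda>x. indicator (\<Union>n\<in>insert n J. A n) x * g x) = \<phi> ?gA + \<phi> ?gU"
    using \<phi> L unfolding dual_space_def by auto
  have "(LINT x:(\<Union>n\<in>insert n J. A n)|M. \<bar>g x\<bar>) = (LINT x:A n|M. \<bar>g x\<bar>) + (LINT x:?U|M. \<bar>g x\<bar>)"
    using set_integral_Un[OF dis, of M "\<lambda>x. \<bar>g x\<bar>"] g' by (simp add: set_integrable_integrable)
  with 1 2 insert show ?case by (simp add: distrib_left)
qed

text \<open>Restrictions of \<open>g\<close> to finitely many atoms converge to \<open>g\<close> in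
  the norm, by dominated convergence. The continuity of \<open>\<phi>\<close> then carries the bound
  from finite unions to \<open>g\<close>.\<close>

lemma dual_space_bound:
  fixes g :: "'a \<Rightarrow> real"
  assumes \<phi>: "\<phi> \<in> dual_space (L1 M) (L1_norm M)" and g: "g \<in> L1 M"
    and I: "countable I" "I \<noteq> {}"
    and atom: "\<And>n. n \<in> I \<Longrightarrow> is_atom M (A n)" and disj: "disjoint_family_on A I"
    and cover: "space M - (\<Union>n\<in>I. A n) \<in> null_sets M"
    and K: "\<And>n. n \<in> I \<Longrightarrow> \<bar>\<phi> (atom_unit M (A n))\<bar> \<le> K"
  shows "\<bar>\<phi> g\<bar> \<le> K * L1_norm M g"
proof -
  have g': "integrable M g" using g by (simp add: L1_def)
  have K0: "0 \<le> K" using I(2) K by fastforce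
  \<comment> \<open>\<open>from_nat_into\<close> enumerates \<open>I\<close>, with repetitions when
    \<open>I\<close> is finite, so finite and infinite index sets need no separate
    treatment.\<close>
  define U where "U k = (\<Union>n\<in>from_nat_into I ` {..k}. A n)" for k :: nat
  have sub: "from_nat_into I ` {..k} \<subseteq> I" for k using from_nat_into[OF I(2)] by auto
  have Um [measurable]: "U k \<in> sets M" for k
    unfolding U_def using sub atom by (intro sets.finite_UN) (auto simp: is_atom_def)
  define h where "h k x = indicator (U k) x * g x" for k x
  have hL: "h k \<in> L1 M" for k
    using integrable_mult_indicator[OF Um g'] by (simp add: L1_def h_def[abs_def])
  obtain C where C: "\<And>x. x \<in> L1 M \<Longrightarrow> \<bar>\<phi> x\<bar> \<le> C * L1_norm M x"
    using \<phi> unfolding dual_space_def by blast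
  have "(\<lambda>k. L1_norm M (g - h k)) \<longlonglongrightarrow> (\<integral>x. 0 \<partial>M)"
    unfolding L1_norm_def
  proof (rule integral_dominated_convergence[where w = "\<lambda>x. \<bar>g x\<bar>"])
    show "AE x in M. (\<lambda>k. \<bar>(g - h k) x\<bar>) \<longlonglongrightarrow> 0"
    proof (rule AE_I'[OF cover], safe)
      fix x n assume x: "x \<in> A n" "n \<in> I" and not: "\<not> (\<lambda>k. \<bar>(g - h k) x\<bar>) \<longlonglongrightarrow> 0"
      obtain j where j: "from_nat_into I j = n"
        using from_nat_into_surj[OF I(1) x(2)] by auto
      have "x \<in> U k" if "j \<le> k" for k
        using that x j unfolding U_def by auto
      then have "eventually (\<lambda>k. \<bar>(g - h k) x\<bar> = 0) sequentially"
        by (auto simp: eventually_sequentially h_def intro!: exI[of _ j])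
      with not show False by (simp add: tendsto_eventually)
    qed
    show "AE x in M. norm \<bar>(g - h k) x\<bar> \<le> \<bar>g x\<bar>" for k
      by (auto simp: h_def indicator_def)
    show "(\<lambda>x. \<bar>(g - h k) x\<bar>) \<in> borel_measurable M" for k
      using hL[of k] g' by (auto simp: L1_def)
  qed (use g' in auto)
  \<comment> \<open>The bound \<open>C\<close> may exceed \<open>K\<close>, but it only multiplies
    an error tending to zero and disappears in the limit.\<close>
  then have "(\<lambda>k. K * L1_norm M g + C * L1_norm M (g - h k)) \<longlonglongrightarrow> K * L1_norm M g + C * 0"
    by (intro tendsto_intros) simp
  moreover have "\<bar>\<phi> g\<bar> \<le> K * L1_norm M g + C * L1_norm M (g - h k)" for k
  proof -
    have d: "g - h k \<in> L1 M" by (rule subspace_diff[OF subspace_L1 g hL])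
    have "\<phi> ((g - h k) + h k) = \<phi> (g - h k) + \<phi> (h k)"
      using \<phi> d hL unfolding dual_space_def by blast
    then have "\<bar>\<phi> g\<bar> \<le> \<bar>\<phi> (h k)\<bar> + \<bar>\<phi> (g - h k)\<bar>" by simp
    moreover have "\<bar>\<phi> (h k)\<bar> \<le> K * (LINT x:U k|M. \<bar>g x\<bar>)"
      using dual_space_bound_on_atoms[OF \<phi> g _ sub atom disj K]
      unfolding h_def[abs_def] U_def by simp
    moreover have "(LINT x:U k|M. \<bar>g x\<bar>) \<le> L1_norm M g"
      unfolding L1_norm_def set_lebesgue_integral_def
      using g' integrable_mult_indicator[OF Um integrable_abs[OF g']]
      by (intro integral_mono) (auto simp: indicator_def)
    ultimately show ?thesis using C[OF d] mult_left_mono[OF _ K0] by (smt (verit))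
  qed
  ultimately show ?thesis
    by (intro LIMSEQ_le_const[of _ "K * L1_norm M g"]) auto
qed

text \<open>If \<open>\<bar>\<phi>\<bar>\<close> were at most \<open>1 - \<delta>\<close> at every
  normalised indicator, \<open>dual_space_bound\<close> would force the dual norm below 1. So some
  indicator nearly norms \<open>\<phi>\<close>, and a sign moves it into the slice.\<close>

lemma slice_contains_atom_unit:
  assumes \<phi>: "\<phi> \<in> dual_sphere (L1 M) (L1_norm M)" and \<delta>: "0 < \<delta>"
    and I: "countable I" "I \<noteq> {}"
    and atom: "\<And>n. n \<in> I \<Longrightarrow> is_atom M (A n)" and disj: "disjoint_family_on A I"
    and cover: "space M - (\<Union>n\<in>I. A n) \<in> null_sets M"
  obtains n s where "n \<in> I" "\<bar>s\<bar> = 1" "s *\<^sub>R atom_unit M (A n) \<in> slice (L1 M) (L1_norm M) \<phi> \<delta>"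
proof -
  have ds: "\<phi> \<in> dual_space (L1 M) (L1_norm M)" and dn: "dual_norm (L1 M) (L1_norm M) \<phi> = 1"
    using \<phi> by (auto simp: dual_sphere_def)
  have "\<exists>n\<in>I. 1 - \<delta> < \<bar>\<phi> (atom_unit M (A n))\<bar>"
  proof (rule ccontr)
    assume "\<not> ?thesis"
    then have le: "\<And>n. n \<in> I \<Longrightarrow> \<bar>\<phi> (atom_unit M (A n))\<bar> \<le> 1 - \<delta>" by force
    \<comment> \<open>An absolute value lies below \<open>1 - \<delta>\<close> because
      \<open>I\<close> is nonempty; this sign allows the bound to be extended to all
      \<open>y\<close> of norm at most 1.\<close>
    have \<delta>1: "0 \<le> 1 - \<delta>" using I(2) le by fastforce
    have "dual_norm (L1 M) (L1_norm M) \<phi> \<le> 1 - \<delta>"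
      unfolding dual_norm_def
    proof (rule cSUP_least)
      have "0 \<in> unit_ball_on (L1 M) (L1_norm M)"
        using subspace_0[OF subspace_L1] by (auto simp: unit_ball_on_def L1_norm_def)
      then show "unit_ball_on (L1 M) (L1_norm M) \<noteq> {}" by auto
      fix y assume "y \<in> unit_ball_on (L1 M) (L1_norm M)"
      then have y: "y \<in> L1 M" "L1_norm M y \<le> 1" by (auto simp: unit_ball_on_def)
      have "\<bar>\<phi> y\<bar> \<le> (1 - \<delta>) * L1_norm M y"
        by (rule dual_space_bound[OF ds y(1) I atom disj cover le])
      also have "\<dots> \<le> 1 - \<delta>" using mult_left_mono[OF y(2) \<delta>1] by simp
      finally show "\<bar>\<phi> y\<bar> \<le> 1 - \<delta>" .
    qed
    with dn \<delta> show False by simp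
  qed
  then obtain n where n: "n \<in> I" "1 - \<delta> < \<bar>\<phi> (atom_unit M (A n))\<bar>" by auto
  define s :: real where "s = (if 0 \<le> \<phi> (atom_unit M (A n)) then 1 else - 1)"
  have s: "\<bar>s\<bar> = 1" by (simp add: s_def)
  have e: "atom_unit M (A n) \<in> L1 M" using atom_unit_L1[OF atom[OF n(1)]] .
  have "\<phi> (s *\<^sub>R atom_unit M (A n)) = s * \<phi> (atom_unit M (A n))"
    using ds e unfolding dual_space_def by blast
  then have "s *\<^sub>R atom_unit M (A n) \<in> slice (L1 M) (L1_norm M) \<phi> \<delta>"
    using n s subspace_scale[OF subspace_L1 e] L1_norm_atom_unit[OF atom[OF n(1)]]
    by (auto simp: slice_def unit_ball_on_def L1_norm_scaleR s_def split: if_splits)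
  with n(1) s show thesis by (rule that)
qed

section \<open>The formula for the Daugavet constant\<close>

theorem proposition3p6:
  fixes M :: "'a measure" and A :: "'i \<Rightarrow> 'a set" and I :: "'i set" and f :: "'a \<Rightarrow> real"
  assumes "sigma_finite_measure M"
    and "emeasure M (space M) \<noteq> 0"
    and "atomic_measure M"
    and "countable I"
    and "\<And>n. n \<in> I \<Longrightarrow> is_atom M (A n)"
    and "disjoint_family_on A I"
    and "space M - (\<Union>n\<in>I. A n) \<in> null_sets M"
    and "f \<in> L1 M"
    and "L1_norm M f \<le> 1"
  shows "daugavet_const (L1 M) (L1_norm M) f =
    1 + L1_norm M f - 2 * (SUP n\<in>I. \<bar>atom_value M f (A n)\<bar> * measure M (A n))"
proof -
  note atom = assms(5)
  have f: "integrable M f" using assms(8) by (simp add: L1_def)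
  \<comment> \<open>Without atoms the whole space would be a null set. Nonemptiness gives the real
    supremum over \<open>I\<close> its meaning.\<close>
  have I: "I \<noteq> {}" using assms(2,7) by auto
  let ?a = "\<lambda>n. LINT x:A n|M. f x"
  define S where "S = (SUP n\<in>I. \<bar>?a n\<bar>)"
  have S_eq: "(SUP n\<in>I. \<bar>atom_value M f (A n)\<bar> * measure M (A n)) = S"
    unfolding S_def
  proof (rule SUP_cong)
    fix n assume "n \<in> I"
    then show "\<bar>atom_value M f (A n)\<bar> * measure M (A n) = \<bar>?a n\<bar>"
      using atom_measure_pos[OF atom] by (fastforce simp: atom_value_eq[OF atom f])
  qed simp
  have le: "\<bar>?a n\<bar> \<le> L1_norm M f" if "n \<in> I" for n
    using abs_set_integral_le_L1_norm[OF atom[OF that] assms(8)] .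
  have aS: "\<bar>?a n\<bar> \<le> S" if "n \<in> I" for n
    unfolding S_def using that le by (intro cSUP_upper bdd_aboveI2) auto
  have SN: "S \<le> L1_norm M f"
    unfolding S_def using I le by (rule cSUP_least)
  let ?c = "1 + L1_norm M f - 2 * S"
  have "daugavet_const (L1 M) (L1_norm M) f = ?c"
    unfolding daugavet_const_def
  \<comment> \<open>The supremum is attained: \<open>?c\<close> itself is admissible, and no
    admissible \<open>\<alpha>\<close> exceeds it.\<close>
  proof (rule cSup_eq_maximum)
    show "?c \<in> {\<alpha>. 0 \<le> \<alpha> \<and> (\<forall>\<epsilon>>0. \<forall>\<delta>>0. \<forall>\<phi>\<in>dual_sphere (L1 M) (L1_norm M).
      \<exists>y\<in>slice (L1 M) (L1_norm M) \<phi> \<delta>. L1_norm M (y - f) > \<alpha> - \<epsilon>)}"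
    proof (intro CollectI conjI allI impI ballI)
      \<comment> \<open>From \<open>S \<le> L1_norm M f \<le> 1\<close> it follows that
        \<open>?c\<close> is at least \<open>1 - L1_norm M f\<close>.\<close>
      show "0 \<le> ?c" using SN assms(9) by simp
      fix \<epsilon> \<delta> :: real and \<phi>
      assume \<epsilon>: "0 < \<epsilon>" and \<delta>: "0 < \<delta>" and \<phi>: "\<phi> \<in> dual_sphere (L1 M) (L1_norm M)"
      obtain n s where n: "n \<in> I" "\<bar>s\<bar> = 1"
        and y: "s *\<^sub>R atom_unit M (A n) \<in> slice (L1 M) (L1_norm M) \<phi> \<delta>"
        using slice_contains_atom_unit[OF \<phi> \<delta> assms(4) I atom assms(6,7)] by metis
      show "\<exists>y\<in>slice (L1 M) (L1_norm M) \<phi> \<delta>. L1_norm M (y - f) > ?c - \<epsilon>"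
        using L1_norm_diff_atom_unit[OF atom[OF n(1)] assms(8) n(2)] aS[OF n(1)] \<epsilon>
        by (intro bexI[OF _ y]) linarith
    qed
  next
    fix \<alpha> assume "\<alpha> \<in> {\<alpha>. 0 \<le> \<alpha> \<and> (\<forall>\<epsilon>>0. \<forall>\<delta>>0. \<forall>\<phi>\<in>dual_sphere (L1 M) (L1_norm M).
      \<exists>y\<in>slice (L1 M) (L1_norm M) \<phi> \<delta>. L1_norm M (y - f) > \<alpha> - \<epsilon>)}"
    then have \<alpha>: "\<exists>y\<in>slice (L1 M) (L1_norm M) \<phi> \<delta>. L1_norm M (y - f) > \<alpha> - \<epsilon>"
      if "0 < \<epsilon>" "0 < \<delta>" "\<phi> \<in> dual_sphere (L1 M) (L1_norm M)" for \<epsilon> \<delta> \<phi>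
      using that by blast
    \<comment> \<open>Each atom alone bounds \<open>\<alpha>\<close> from above; the supremum over
      the atoms is taken afterwards.\<close>
    have "2 * \<bar>?a n\<bar> \<le> 1 + L1_norm M f - \<alpha>" if n: "n \<in> I" for n
    proof (rule field_le_epsilon)
      fix e :: real assume e: "0 < e"
      \<comment> \<open>With the sign of \<open>f\<close> on the atom, nearly all mass of
        \<open>y\<close> sits on \<open>A n\<close> with that sign and overlaps \<open>f\<close>,
        which keeps the distance small.\<close>
      define s :: real where "s = (if 0 \<le> ?a n then 1 else - 1)"
      have s: "\<bar>s\<bar> = 1" by (simp add: s_def)
      obtain y where y: "y \<in> L1 M" "L1_norm M y \<le> 1" "s * (LINT x:A n|M. y x) > 1 - e / 4"
        and d: "L1_norm M (y - f) > \<alpha> - e / 4"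
        using \<alpha>[of "e/4" "e/4", OF _ _ atom_functional_dual_sphere[OF atom[OF n] s]] e
        by (auto simp: slice_def unit_ball_on_def)
      let ?b = "LINT x:A n|M. y x"
      \<comment> \<open>Here \<open>s * ?b\<close> lies between \<open>1 - e / 4\<close> and 1,
        while \<open>s * ?a n\<close> is \<open>\<bar>?a n\<bar>\<close>, which is at most
        1.\<close>
      have "\<bar>?b - ?a n\<bar> \<le> 1 - \<bar>?a n\<bar> + e / 4"
        using y(2,3) abs_set_integral_le_L1_norm[OF atom[OF n] y(1)] le[OF n] assms(9) e
        by (cases "0 \<le> ?a n") (simp_all add: s_def)
      moreover have "L1_norm M y - \<bar>?b\<bar> \<le> e / 4"
        using y by (auto simp: s_def split: if_splits)
      \<comment> \<open>Three errors of \<open>e / 4\<close> are added: from the choice of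
        \<open>y\<close>, from the difference on the atom, and from the mass of \<open>y\<close> off
        the atom.\<close>
      ultimately show "2 * \<bar>?a n\<bar> \<le> 1 + L1_norm M f - \<alpha> + e"
        using L1_norm_diff_le[OF atom[OF n] assms(8) y(1)] d e by linarith
    qed
    then have "\<bar>?a n\<bar> \<le> (1 + L1_norm M f - \<alpha>) / 2" if "n \<in> I" for n
      using that by fastforce
    then have "S \<le> (1 + L1_norm M f - \<alpha>) / 2"
      unfolding S_def using I by (intro cSUP_least)
    then show "\<alpha> \<le> ?c" by simp
  qed
  then show ?thesis by (simp add: S_eq)
qed

end
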